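(* Let $f:[0,\infty)\to[0,\infty)$ be a locally Lipschitz, convex function with $f(0)=0$, $f(u)>0$ for all $u>0$, $\int_1^\infty \frac{du}{f(u)}<\infty$ and $\lim_{u\to\infty}\frac{f(u)}{u}=+\infty$. Let $(\mathbb{T},\omega_0,\mu_1)$ be a model tree with root $x_0\in\mathbb{T}$ and branching function $b$. Suppose that $$B:=\sup_{r\in\mathbb{N}_0}b(r)<+\infty,$$ and let $a>\log(B)$. Let $u_0:\mathbb{T}\to[0,+\infty)$ be bounded with $u_0\not\equiv0$, and let $u$ be a solution of $u_t-\Delta u=f(u)$ in $\mathbb{T}\times(0,T)$, $u=u_0$ in $\mathbb{T}\times\{0\}$, with maximal time of existence $T\in(0,+\infty]$. Define $$\varphi(x):=C\,e^{-a\,r(x)}\quad\text{for all }x\in\mathbb{T},\qquad C:=\Bigl\{1+\sum_{r=1}^{+\infty}\Bigl[\prod_{k=0}^{r-1}b(k)\Bigr]e^{-ar}\Bigr\}^{-1},$$ where $r(x):=\rho(x,x_0)$, and let $\lambda\ge B$. If $$\sum_{x\in\mathbb{T}}u_0(x)\,\varphi(x)>s_0(\lambda),\qquad\text{where } s_0(\lambda):=\inf\Bigl\{v>0:\ \frac{f(v)}{v}>\lambda\Bigr\},$$ then $u$ blows up in finite time.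
   Context: $\mathbb{N}=\{1,2,\dots\}$, $\mathbb{N}_0=\mathbb{N}\cup\{0\}$. Weighted graph: $X$ is a countably infinite set, $\mu:X\to(0,+\infty)$, and $\omega:X\times X\to[0,+\infty)$ satisfies $\omega(x,x)=0$, $\omega(x,y)=\omega(y,x)$ and $\sum_{y\in X}\omega(x,y)<+\infty$ for all $x,y\in X$; $x\sim y$ means $\omega(x,y)>0$; $\deg(x):=\sum_{y\in X}\omega(x,y)$. The graph is connected if any two vertices are joined by a finite path; $\rho(x,y)$ is the minimal number of edges in a path from $x$ to $y$ (combinatorial distance). Laplacian: $\Delta g(x):=\frac1{\mu(x)}\sum_{y\in X}\omega(x,y)[g(y)-g(x)]$, acting on the space variable of $u(x,t)$. $\ell^\infty(X)$ is the set of bounded functions on $X$, with the sup norm $\|\cdot\|_\infty$. Model tree with root $x_0$: a connected weighted graph $(\mathbb{T},\omega_0,\mu_1)$ with $x_0\in\mathbb{T}$ such that, with $S_r(x_0):=\{x\in\mathbb{T}:\rho(x,x_0)=r\}$: (a) $\omega_0(x,y)=1$ if $x\sim y$ and $0$ otherwise; (b) $\omega_0(x,y)=0$ for all $x,y\in S_r(x_0)$, for each $r\in\mathbb{N}_0$; (c) $\mu_1\equiv1$; (d) every $x\ne x_0$ has exactly one neighbor $y$ with $\rho(y,x_0)=\rho(x,x_0)-1$; (e) $\deg(x)$ depends only on $\rho(x,x_0)$, written $\deg(r)$ for $x\in S_r(x_0)$. Its branching function $b:\mathbb{N}_0\to\mathbb{N}$ is $b(0):=\deg(x_0)$ and $b(r):=\deg(r)-1$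 for $r\in\mathbb{N}$ (so $b(r)\ge1$ for all $r$). Solution: a function $u:\mathbb{T}\times[0,T)\to\mathbb{R}$ with $u(x,\cdot)\in C^1((0,T))\cap C^0([0,T))$ for all $x$, $u\in L^\infty(\mathbb{T}\times[0,T'])$ for all $T'\in(0,T)$, $u\ge0$ in $\mathbb{T}\times(0,T)$, and satisfying the equation and the initial condition pointwise. The solution is considered up to its maximal time of existence $T\in(0,+\infty]$, and by convention exactly one of two alternatives holds: either $T=+\infty$ and $u(\cdot,t)\in\ell^\infty(\mathbb{T})$ for all $t>0$ ($u$ is global), or $T<+\infty$ and $\lim_{t\to T^-}\|u(\cdot,t)\|_\infty=+\infty$. "$u$ blows up in finite time" means that the maximal time of existence is finite, $0<T<+\infty$, with $u(\cdot,t)\in\ell^\infty(\mathbb{T})$ for all $t\in(0,T)$ and $\lim_{t\to T^-}\|u(\cdot,t)\|_\infty=+\infty$. *)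

theory Defs
  imports "HOL-Analysis.Analysis"
begin

text \<open>
  The vertex set is a carrier \<open>V\<close>; values of \<open>\<omega>\<close>, \<open>\<mu>\<close> and of functions on vertices outside
  \<open>V\<close> are irrelevant. For nonnegative weights, \<open>summable_on\<close> is finiteness of the sum.
\<close>

locale weighted_graph =
  fixes V :: "'a set" and \<omega> :: "'a \<Rightarrow> 'a \<Rightarrow> real" and \<mu> :: "'a \<Rightarrow> real"
  assumes countable_V: "countable V"
    and infinite_V: "infinite V"
    and measure_pos: "x \<in> V \<Longrightarrow> \<mu> x > 0"
    and weight_nonneg: "x \<in> V \<Longrightarrow> y \<in> V \<Longrightarrow> \<omega> x y \<ge> 0"
    and weight_diag: "x \<in> V \<Longrightarrow> \<omega> x x = 0"
    and weight_sym: "x \<in> V \<Longrightarrow> y \<in> V \<Longrightarrow> \<omega> x y = \<omega> y x"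
    and weight_summable: "x \<in> V \<Longrightarrow> (\<lambda>y. \<omega> x y) summable_on V"

definition adjacent :: "('a \<Rightarrow> 'a \<Rightarrow> real) \<Rightarrow> 'a \<Rightarrow> 'a \<Rightarrow> bool" where
  "adjacent \<omega> x y \<longleftrightarrow> \<omega> x y > 0"

definition degree :: "'a set \<Rightarrow> ('a \<Rightarrow> 'a \<Rightarrow> real) \<Rightarrow> 'a \<Rightarrow> real" where
  "degree V \<omega> x = (\<Sum>\<^sub>\<infinity>y\<in>V. \<omega> x y)"

definition laplacian ::
  "'a set \<Rightarrow> ('a \<Rightarrow> 'a \<Rightarrow> real) \<Rightarrow> ('a \<Rightarrow> real) \<Rightarrow> ('a \<Rightarrow> real) \<Rightarrow> 'a \<Rightarrow> real" where
  "laplacian V \<omega> \<mu> g x = 1 / \<mu> x * (\<Sum>\<^sub>\<infinity>y\<in>V. \<omega> x y * (g y - g x))"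

text \<open>A path is the list of its vertices, so its number of edges is its length minus one.\<close>

definition path_between ::
  "'a set \<Rightarrow> ('a \<Rightarrow> 'a \<Rightarrow> real) \<Rightarrow> 'a \<Rightarrow> 'a list \<Rightarrow> 'a \<Rightarrow> bool" where
  "path_between V \<omega> x p y \<longleftrightarrow>
     p \<noteq> [] \<and> set p \<subseteq> V \<and> successively (adjacent \<omega>) p \<and> hd p = x \<and> last p = y"

definition connected_graph :: "'a set \<Rightarrow> ('a \<Rightarrow> 'a \<Rightarrow> real) \<Rightarrow> bool" where
  "connected_graph V \<omega> \<longleftrightarrow> (\<forall>x\<in>V. \<forall>y\<in>V. \<exists>p. path_between V \<omega> x p y)"

definition graph_dist :: "'a set \<Rightarrow> ('a \<Rightarrow> 'a \<Rightarrow> real) \<Rightarrow> 'a \<Rightarrow> 'a \<Rightarrow> nat" where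
  "graph_dist V \<omega> x y = (LEAST n. \<exists>p. path_between V \<omega> x p y \<and> length p = Suc n)"

definition graph_sphere :: "'a set \<Rightarrow> ('a \<Rightarrow> 'a \<Rightarrow> real) \<Rightarrow> 'a \<Rightarrow> nat \<Rightarrow> 'a set" where
  "graph_sphere V \<omega> x0 r = {x \<in> V. graph_dist V \<omega> x x0 = r}"

locale model_tree = weighted_graph V \<omega> \<mu>
  for V :: "'a set" and \<omega> :: "'a \<Rightarrow> 'a \<Rightarrow> real" and \<mu> :: "'a \<Rightarrow> real" +
  fixes x0 :: 'a
  assumes root_in: "x0 \<in> V"
    and connected: "connected_graph V \<omega>"
    and weight_01: "x \<in> V \<Longrightarrow> y \<in> V \<Longrightarrow> \<omega> x y = (if adjacent \<omega> x y then 1 else 0)"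
    and weight_sphere:
      "x \<in> graph_sphere V \<omega> x0 r \<Longrightarrow> y \<in> graph_sphere V \<omega> x0 r \<Longrightarrow> \<omega> x y = 0"
    and measure_one: "x \<in> V \<Longrightarrow> \<mu> x = 1"
    and unique_parent: "x \<in> V \<Longrightarrow> x \<noteq> x0 \<Longrightarrow>
      \<exists>!y. y \<in> V \<and> adjacent \<omega> x y \<and> Suc (graph_dist V \<omega> y x0) = graph_dist V \<omega> x x0"
    and degree_spherical:
      "x \<in> graph_sphere V \<omega> x0 r \<Longrightarrow> y \<in> graph_sphere V \<omega> x0 r \<Longrightarrow>
        degree V \<omega> x = degree V \<omega> y"

text \<open>
  In a model tree every sphere is nonempty and every degree is a positive integer (at least two
  away from the root), so exactly one \<open>b\<close> satisfies this predicate, and its values are positive.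
\<close>

definition branching_function ::
  "'a set \<Rightarrow> ('a \<Rightarrow> 'a \<Rightarrow> real) \<Rightarrow> 'a \<Rightarrow> (nat \<Rightarrow> nat) \<Rightarrow> bool" where
  "branching_function V \<omega> x0 b \<longleftrightarrow>
     real (b 0) = degree V \<omega> x0 \<and>
     (\<forall>r\<ge>1. \<forall>x\<in>graph_sphere V \<omega> x0 r. real (b r) = degree V \<omega> x - 1)"

definition in_linfty :: "'a set \<Rightarrow> ('a \<Rightarrow> real) \<Rightarrow> bool" where
  "in_linfty V g \<longleftrightarrow> bounded (g ` V)"

text \<open>Only meaningful for \<open>g\<close> with \<open>in_linfty V g\<close>.\<close>

definition sup_norm :: "'a set \<Rightarrow> ('a \<Rightarrow> real) \<Rightarrow> real" where
  "sup_norm V g = (SUP x\<in>V. \<bar>g x\<bar>)"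

text \<open>
  For functions continuous in time, membership in \<open>L\<^sup>\<infinity>\<close> of \<open>V \<times> [0, T']\<close> is plain boundedness,
  since no vertex has measure zero.
\<close>

definition is_solution ::
  "'a set \<Rightarrow> ('a \<Rightarrow> 'a \<Rightarrow> real) \<Rightarrow> ('a \<Rightarrow> real) \<Rightarrow> (real \<Rightarrow> real) \<Rightarrow> ('a \<Rightarrow> real) \<Rightarrow>
    ereal \<Rightarrow> ('a \<Rightarrow> real \<Rightarrow> real) \<Rightarrow> bool" where
  "is_solution V \<omega> \<mu> f u0 T u \<longleftrightarrow>
     0 < T \<and>
     (\<forall>x\<in>V. u x C1_differentiable_on {t. 0 < t \<and> ereal t < T} \<and>
             continuous_on {t. 0 \<le> t \<and> ereal t < T} (u x)) \<and>
     (\<forall>T'. 0 < T' \<and> ereal T' < T \<longrightarrow> bounded {u x t | x t. x \<in> V \<and> 0 \<le> t \<and> t \<le> T'}) \<and>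
     (\<forall>x\<in>V. \<forall>t. 0 < t \<and> ereal t < T \<longrightarrow> u x t \<ge> 0) \<and>
     (\<forall>x\<in>V. \<forall>t. 0 < t \<and> ereal t < T \<longrightarrow>
        deriv (u x) t - laplacian V \<omega> \<mu> (\<lambda>y. u y t) x = f (u x t)) \<and>
     (\<forall>x\<in>V. u x 0 = u0 x)"

definition is_global :: "'a set \<Rightarrow> ereal \<Rightarrow> ('a \<Rightarrow> real \<Rightarrow> real) \<Rightarrow> bool" where
  "is_global V T u \<longleftrightarrow> T = \<infinity> \<and> (\<forall>t>0. in_linfty V (\<lambda>x. u x t))"

definition norm_explodes :: "'a set \<Rightarrow> ereal \<Rightarrow> ('a \<Rightarrow> real \<Rightarrow> real) \<Rightarrow> bool" where
  "norm_explodes V T u \<longleftrightarrow>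
     T < \<infinity> \<and> filterlim (\<lambda>t. sup_norm V (\<lambda>x. u x t)) at_top (at_left (real_of_ereal T))"

text \<open>
  The maximal time of existence is fixed by the usual dichotomy; in either case \<open>u\<close> has no
  continuation as a solution to a strictly larger time interval, because solutions are bounded on
  compact time intervals.
\<close>

definition is_maximal_solution ::
  "'a set \<Rightarrow> ('a \<Rightarrow> 'a \<Rightarrow> real) \<Rightarrow> ('a \<Rightarrow> real) \<Rightarrow> (real \<Rightarrow> real) \<Rightarrow> ('a \<Rightarrow> real) \<Rightarrow>
    ereal \<Rightarrow> ('a \<Rightarrow> real \<Rightarrow> real) \<Rightarrow> bool" where
  "is_maximal_solution V \<omega> \<mu> f u0 T u \<longleftrightarrow>
     is_solution V \<omega> \<mu> f u0 T u \<and> (is_global V T u \<or> norm_explodes V T u)"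

definition blows_up_in_finite_time :: "'a set \<Rightarrow> ereal \<Rightarrow> ('a \<Rightarrow> real \<Rightarrow> real) \<Rightarrow> bool" where
  "blows_up_in_finite_time V T u \<longleftrightarrow>
     0 < T \<and> T < \<infinity> \<and>
     (\<forall>t. 0 < t \<and> ereal t < T \<longrightarrow> in_linfty V (\<lambda>x. u x t)) \<and>
     filterlim (\<lambda>t. sup_norm V (\<lambda>x. u x t)) at_top (at_left (real_of_ereal T))"

definition locally_lipschitz_on :: "real set \<Rightarrow> (real \<Rightarrow> real) \<Rightarrow> bool" where
  "locally_lipschitz_on S f \<longleftrightarrow> (\<forall>x\<in>S. \<exists>e>0. \<exists>L. L-lipschitz_on (cball x e \<inter> S) f)"

definition s0 :: "(real \<Rightarrow> real) \<Rightarrow> real \<Rightarrow> real" where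
  "s0 f l = Inf {v. v > 0 \<and> f v / v > l}"

end

theory Submission
  imports Defs
begin

text \<open>
  The proof is Kaplan's eigenfunction method: the solution is averaged against a weight \<open>w\<close> with
  \<open>\<Delta>w \<ge> - B w\<close>, and the average obeys an ordinary differential
  inequality that has no global solution.

  The weight is \<open>e\<^sup>-\<^sup>a\<^sup>r\<close> cut off outside the ball of radius \<open>n\<close> about the root. Cutting off costs
  nothing: at a vertex \<open>x \<noteq> x\<^sub>0\<close> of the ball the weight \<open>w\<close> satisfies
  \<open>\<Delta>w(x) \<ge> w(parent x) - deg(x) w(x) \<ge> - b(r) w(x)\<close>, the children having been dropped
  since \<open>w \<ge> 0\<close>, and at the root \<open>\<Delta>w \<ge> - deg(x\<^sub>0) w = - b(0) w\<close>. So every truncation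
  satisfies \<open>\<Delta>w \<ge> - B w\<close> on its support, and all sums over the tree, their derivatives in time and
  Green's formula become finite statements (\<open>root_ball_laplacian_test\<close>).

  As a sphere of radius \<open>r\<close> has at most \<open>b(0) \<cdots> b(r-1)\<close> points, \<open>C\<close> turns each truncation into a weight of
  total mass at most one (\<open>root_ball_mass_le\<close>; the series converges because \<open>B e\<^sup>-\<^sup>a < 1\<close>). Jensen's
  inequality survives for such weights since \<open>f 0 = 0\<close>, the missing mass being placed at \<open>0\<close>
  (\<open>convex_on_sum_sub_probability\<close>). Hence \<open>g(t) = \<Sum> \<phi>(x) u(x,t)\<close>, summed over a ball, satisfies
  \<open>g' \<ge> f(g) - B g\<close>. For a large radius \<open>g(0)\<close> still exceeds \<open>s0 f l\<close>.

  Convexity makes \<open>f v / v\<close> nondecreasing, so above \<open>s0 f l\<close> the linear term is absorbed into a fixed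
  fraction of \<open>f\<close>, which gives \<open>g' \<ge> e f(g)\<close> with \<open>e > 0\<close>. Then \<open>\<integral> dv / f(v)\<close>, taken up to \<open>g(t)\<close>, grows at
  least like \<open>e t\<close> while staying bounded, so \<open>g\<close> cannot exist for all times
  (\<open>superlinear_differential_inequality_not_global\<close>). This excludes \<open>T = \<infinity>\<close>, and the dichotomy for
  maximal solutions leaves blow-up.
\<close>

section \<open>Convex functions and a blow-up criterion for differential inequalities\<close>

lemma convex_on_ratio_mono:
  fixes f :: "real \<Rightarrow> real"
  assumes "convex_on {0..} f" and "f 0 = 0" and "0 < v" and "v \<le> w"
  shows "f v / v \<le> f w / w"
proof -
  have "f ((1 - v / w) *\<^sub>R 0 + (v / w) *\<^sub>R w) \<le> (1 - v / w) * f 0 + (v / w) * f w"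
    using assms by (intro convex_onD[OF assms(1)]) auto
  hence "f v \<le> v / w * f w" using assms by simp
  thus ?thesis using assms by (simp add: field_simps)
qed

text \<open>
  Jensen's inequality with the missing mass placed at the point \<open>0\<close>, where \<open>f\<close> vanishes. The extra
  point is the index \<open>None\<close>.
\<close>

lemma convex_on_sum_sub_probability:
  fixes f :: "real \<Rightarrow> real"
  assumes "convex_on {0..} f" and "f 0 = 0" and "finite S"
    and p: "\<And>i. i \<in> S \<Longrightarrow> 0 \<le> p i" "(\<Sum>i\<in>S. p i) \<le> 1"
    and y: "\<And>i. i \<in> S \<Longrightarrow> 0 \<le> y i"
  shows "f (\<Sum>i\<in>S. p i * y i) \<le> (\<Sum>i\<in>S. p i * f (y i))"
proof -
  define q where "q = case_option (1 - (\<Sum>i\<in>S. p i)) p"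
  define z where "z = case_option 0 y"
  define S' where "S' = insert None (Some ` S)"
  have split: "(\<Sum>i\<in>S'. h i) = h None + (\<Sum>i\<in>S. h (Some i))" for h :: "_ \<Rightarrow> real"
    unfolding S'_def using \<open>finite S\<close> by (subst sum.insert) (auto simp: sum.reindex)
  have "f (\<Sum>i\<in>S'. q i *\<^sub>R z i) \<le> (\<Sum>i\<in>S'. q i * f (z i))"
  proof (rule convex_on_sum[OF _ _ assms(1)])
    show "sum q S' = 1" unfolding split by (simp add: q_def)
  qed (use assms in \<open>auto simp: S'_def q_def z_def\<close>)
  thus ?thesis unfolding real_scaleR_def split using assms(2) by (simp add: q_def z_def)
qed

text \<open>
  The start \<open>c\<close> may lie below \<open>1\<close>; the part of the integral below \<open>max c 1\<close> is a constant, and the rest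
  is at most the tail integral.
\<close>

lemma bounded_primitive_of_tail_integrable:
  fixes h :: "real \<Rightarrow> real"
  assumes h: "set_integrable lborel {1..} h" and cont: "continuous_on {c..} h"
    and nonneg: "\<And>v. v \<ge> c \<Longrightarrow> 0 \<le> h v" "\<And>v. v \<ge> 1 \<Longrightarrow> 0 \<le> h v"
  shows "\<exists>K. \<forall>v\<ge>c. integral {c..v} h \<le> K"
proof (intro exI allI impI)
  fix v assume "c \<le> v"
  have int: "h integrable_on {p..q}" if "c \<le> p" for p q
    using that by (intro integrable_continuous_real continuous_on_subset[OF cont]) auto
  let ?w = "max c 1" and ?z = "max v (max c 1)"
  have "integral {c..v} h \<le> integral {c..?z} h"
    by (intro integral_subset_le int) (auto intro: nonneg)
  also have "\<dots> = integral {c..?w} h + integral {?w..?z} h"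
    by (intro Henstock_Kurzweil_Integration.integral_combine[symmetric] int) auto
  also have "integral {?w..?z} h \<le> integral {1..} h"
    using set_borel_integral_eq_integral(1)[OF h]
    by (intro integral_subset_le int) (auto intro: nonneg)
  finally show "integral {c..v} h \<le> integral {c..max c 1} h + integral {1..} h" by simp
qed

text \<open>
  The hypotheses on \<open>c\<close> start \<open>g\<close> in the region where \<open>f v\<close> dominates \<open>l v\<close>. There \<open>g\<close> increases, so
  it never leaves the region, and Osgood's argument applies: the time needed to get from \<open>g 0\<close> to
  infinity is at most a multiple of the convergent integral of \<open>1 / f\<close>.
\<close>

lemma superlinear_differential_inequality_not_global:
  fixes f g :: "real \<Rightarrow> real"
  assumes convex: "convex_on {0..} f" and zero: "f 0 = 0"
    and pos: "\<And>v. v > 0 \<Longrightarrow> f v > 0"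
    and tail: "set_integrable lborel {1..} (\<lambda>v. 1 / f v)"
    and "0 \<le> l" and c: "0 < c" "f c / c > l" "c < g 0"
    and cont: "continuous_on {0..} g"
    and deriv: "\<And>t. t > 0 \<Longrightarrow> (g has_real_derivative g' t) (at t)"
    and ineq: "\<And>t. t > 0 \<Longrightarrow> f (g t) - l * g t \<le> g' t"
  shows False
proof -
  \<comment> \<open>The fraction of \<open>f\<close> left over once the linear term is absorbed; it is exact at \<open>v = c\<close>, the worst
    case because \<open>f v / v\<close> is nondecreasing.\<close>
  define e where "e = 1 - l * c / f c"
  have "e > 0" using c pos[of c] by (simp add: e_def field_simps)
  have absorb: "e * f v \<le> f v - l * v" if "c \<le> v" for v
  proof -
    have "f c / c \<le> f v / v" by (rule convex_on_ratio_mono) (use convex zero c that in auto)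
    hence "v \<le> c / f c * f v" using c pos[of c] that by (simp add: field_simps)
    hence "l * v \<le> l * (c / f c * f v)" by (rule mult_left_mono) fact
    thus ?thesis by (simp add: e_def algebra_simps)
  qed
  have g_deriv: "e * f (g t) \<le> g' t" if "t > 0" "c \<le> g t" for t
    using absorb[OF that(2)] ineq[OF that(1)] by simp

  have above: "c < g t" if "0 \<le> t" for t
  proof (rule ccontr)
    assume "\<not> c < g t"
    \<comment> \<open>At the first time \<open>s\<close> with \<open>g s \<le> c\<close>, monotonicity up to \<open>s\<close> contradicts \<open>c < g 0\<close>.\<close>
    define Z where "Z = {s \<in> {0..t}. g s \<le> c}"
    have "continuous_on {0..t} g" using cont by (rule continuous_on_subset) auto
    hence "closed ({0..t} \<inter> g -` {..c})" by (rule continuous_closed_preimage) auto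
    moreover have "Z = {0..t} \<inter> g -` {..c}" by (auto simp: Z_def)
    ultimately have "closed Z" by simp
    moreover have "bounded Z" by (rule bounded_subset[of "{0..t}"]) (auto simp: Z_def)
    ultimately have "compact Z" by (simp add: compact_eq_bounded_closed)
    moreover have "Z \<noteq> {}" using \<open>\<not> c < g t\<close> that by (auto simp: Z_def)
    ultimately obtain s where s: "s \<in> Z" "\<And>s'. s' \<in> Z \<Longrightarrow> s \<le> s'"
      using compact_attains_inf by metis
    have "g 0 \<le> g s"
    proof (rule DERIV_nonneg_imp_increasing_open[where f = g])
      fix r assume r: "0 < r" "r < s"
      have "s \<le> t" using s(1) by (simp add: Z_def)
      have "c \<le> g r"
      proof (rule ccontr)
        assume "\<not> c \<le> g r"
        hence "r \<in> Z" using r \<open>s \<le> t\<close> by (simp add: Z_def)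
        thus False using s(2)[of r] r by simp
      qed
      moreover from this have "0 \<le> e * f (g r)" using c \<open>e > 0\<close> pos[of "g r"] by simp
      ultimately have "0 \<le> g' r" using g_deriv[of r] r by simp
      thus "\<exists>y. (g has_real_derivative y) (at r) \<and> 0 \<le> y" using deriv r by blast
    qed (use s in \<open>auto simp: Z_def intro: continuous_on_subset[OF cont]\<close>)
    thus False using s c by (simp add: Z_def)
  qed

  define h where "h = (\<lambda>v. 1 / f v)"
  define G where "G = (\<lambda>v. integral {c..v} h)"
  have "continuous_on {0<..} f"
    by (rule convex_on_continuous) (use convex in \<open>auto intro: convex_on_subset\<close>)
  hence contf: "continuous_on {c..} f" by (rule continuous_on_subset) (use c in auto)
  have conth: "continuous_on {c..} h"
    unfolding h_def
  proof (intro continuous_intros contf ballI)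
    fix v assume "v \<in> {c..}"
    thus "f v \<noteq> 0" using pos[of v] c by simp
  qed
  have "\<exists>K. \<forall>v\<ge>c. integral {c..v} h \<le> K"
  proof (rule bounded_primitive_of_tail_integrable)
    show "set_integrable lborel {1..} h" using tail by (simp add: h_def)
  next
    fix v assume "c \<le> v"
    thus "0 \<le> h v" using pos[of v] c by (simp add: h_def)
  next
    fix v :: real assume "1 \<le> v"
    thus "0 \<le> h v" using pos[of v] by (simp add: h_def)
  qed fact
  then obtain K where K: "\<And>v. c \<le> v \<Longrightarrow> G v \<le> K" by (auto simp: G_def)
  have G_deriv: "(G has_real_derivative h v) (at v)" if "c < v" for v
  proof -
    have "(G has_real_derivative h v) (at v within {c..v + 1})"
      unfolding G_def using that
      by (intro integral_has_real_derivative continuous_on_subset[OF conth]) auto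
    moreover have "at v within {c..v + 1} = at v"
      by (rule at_within_interior) (use that in simp)
    ultimately show ?thesis by simp
  qed
  have growth: "e * t \<le> G (g t) - G (g 0)" if "0 \<le> t" for t
  proof -
    have "G (g 0) - e * 0 \<le> G (g t) - e * t"
    proof (rule DERIV_nonneg_imp_increasing_open[where f = "\<lambda>s. G (g s) - e * s", OF that])
      fix r assume r: "0 < r" "r < t"
      have gr: "c < g r" using above r by simp
      have "((\<lambda>s. G (g s) - e * s) has_real_derivative h (g r) * g' r - e) (at r)"
        by (intro DERIV_diff DERIV_cmult_Id DERIV_chain2[OF G_deriv[OF gr] deriv[OF r(1)]])
      moreover have "e \<le> h (g r) * g' r"
        using g_deriv[of r] r gr pos[of "g r"] c by (simp add: h_def field_simps)
      ultimately show "\<exists>y. ((\<lambda>s. G (g s) - e * s) has_real_derivative y) (at r) \<and> 0 \<le> y"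
        by (intro exI[of _ "h (g r) * g' r - e"]) simp
    next
      have "continuous_on {c<..} G"
        by (intro continuous_at_imp_continuous_on ballI DERIV_isCont[OF G_deriv]) simp
      moreover have "continuous_on {0..t} g" using cont by (rule continuous_on_subset) auto
      moreover have "g ` {0..t} \<subseteq> {c<..}" using above by auto
      ultimately have "continuous_on {0..t} (\<lambda>s. G (g s))"
        by (rule continuous_on_compose2)
      thus "continuous_on {0..t} (\<lambda>s. G (g s) - e * s)" by (intro continuous_intros)
    qed
    thus ?thesis by simp
  qed
  \<comment> \<open>A time at which linear growth has overtaken the bound \<open>K\<close>.\<close>
  define t where "t = (K - G (g 0) + 1) / e"
  have "0 \<le> t" using K[of "g 0"] c \<open>e > 0\<close> by (simp add: t_def)
  from growth[OF this] K[of "g t"] above[OF this] \<open>e > 0\<close> show False by (simp add: t_def)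
qed

section \<open>Combinatorics of model trees\<close>

context model_tree
begin

abbreviation dist_root :: "'a \<Rightarrow> nat" where
  "dist_root x \<equiv> graph_dist V \<omega> x x0"

abbreviation nbrs :: "'a \<Rightarrow> 'a set" where
  "nbrs x \<equiv> {y \<in> V. adjacent \<omega> x y}"

abbreviation root_ball :: "nat \<Rightarrow> 'a set" where
  "root_ball n \<equiv> {x \<in> V. dist_root x \<le> n}"

definition parent :: "'a \<Rightarrow> 'a" where
  "parent x = (THE y. y \<in> V \<and> adjacent \<omega> x y \<and> Suc (dist_root y) = dist_root x)"

lemma adjacent_sym: "x \<in> V \<Longrightarrow> y \<in> V \<Longrightarrow> adjacent \<omega> x y \<Longrightarrow> adjacent \<omega> y x"
  by (simp add: adjacent_def weight_sym)

lemma parent: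
  assumes "x \<in> V" "x \<noteq> x0"
  shows "parent x \<in> V" "adjacent \<omega> x (parent x)" "Suc (dist_root (parent x)) = dist_root x"
  using theI'[OF unique_parent[OF assms]] by (auto simp: parent_def)

lemma dist_root_root [simp]: "dist_root x0 = 0"
proof -
  have "path_between V \<omega> x0 [x0] x0" using root_in by (simp add: path_between_def)
  hence "\<exists>p. path_between V \<omega> x0 p x0 \<and> length p = Suc 0" by (intro exI[of _ "[x0]"]) simp
  thus ?thesis unfolding graph_dist_def by (rule Least_eq_0)
qed

lemma dist_root_eq_0_iff: "x \<in> V \<Longrightarrow> dist_root x = 0 \<longleftrightarrow> x = x0"
  using parent(3)[of x] by (metis dist_root_root nat.distinct(1))

text \<open>All weights are \<open>0\<close> or \<open>1\<close>, so a finite sum of weights at \<open>x\<close> allows only finitely many ones.\<close>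

lemma finite_nbrs: "x \<in> V \<Longrightarrow> finite (nbrs x)"
proof (rule ccontr)
  assume x: "x \<in> V" and inf: "infinite (nbrs x)"
  have "(\<lambda>y. \<omega> x y) summable_on nbrs x"
    by (rule summable_on_subset_banach[OF weight_summable[OF x]]) auto
  also have "(\<lambda>y. \<omega> x y) summable_on nbrs x \<longleftrightarrow> (\<lambda>y. 1::real) summable_on nbrs x"
    using x by (intro summable_on_cong) (auto simp: weight_01)
  finally show False using infsum_diverge_constant[OF inf, of "1::real"] by simp
qed

lemma degree_eq_card: "x \<in> V \<Longrightarrow> degree V \<omega> x = real (card (nbrs x))"
proof -
  assume x: "x \<in> V"
  have "degree V \<omega> x = (\<Sum>\<^sub>\<infinity>y\<in>nbrs x. 1)"
    unfolding degree_def using x by (intro infsum_cong_neutral) (auto simp: weight_01)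
  thus ?thesis using finite_nbrs[OF x] by simp
qed

lemma laplacian_eq_sum_nbrs:
  assumes x: "x \<in> V"
  shows "laplacian V \<omega> \<mu> v x = (\<Sum>y\<in>nbrs x. v y) - degree V \<omega> x * v x"
proof -
  have "laplacian V \<omega> \<mu> v x = (\<Sum>\<^sub>\<infinity>y\<in>V. \<omega> x y * (v y - v x))"
    by (simp add: laplacian_def measure_one x)
  also have "\<dots> = (\<Sum>\<^sub>\<infinity>y\<in>nbrs x. v y - v x)"
    using x by (intro infsum_cong_neutral) (auto simp: weight_01)
  also have "\<dots> = (\<Sum>y\<in>nbrs x. v y) - degree V \<omega> x * v x"
    using finite_nbrs[OF x] by (simp add: sum_subtractf degree_eq_card x)
  finally show ?thesis .
qed

text \<open>
  An infinite connected graph has an edge at the root. This gives \<open>B \<ge> 1\<close>, hence \<open>exp (ln B) = B\<close> and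
  \<open>a > 0\<close> whenever \<open>a > ln B\<close>.
\<close>

lemma branching_root_pos:
  assumes "branching_function V \<omega> x0 b"
  shows "1 \<le> b 0"
proof -
  obtain y where y: "y \<in> V" "y \<noteq> x0"
    using infinite_V by (metis finite.emptyI finite_insert finite_subset insertI1 subsetI)
  then obtain p where p: "path_between V \<omega> x0 p y"
    using connected root_in by (auto simp: connected_graph_def)
  obtain z q where "p = x0 # z # q"
    using p y by (cases p rule: remdups_adj.cases) (auto simp: path_between_def)
  hence "z \<in> nbrs x0" using p by (auto simp: path_between_def)
  hence "0 < card (nbrs x0)" using finite_nbrs[OF root_in] by (auto simp: card_gt_0_iff)
  thus ?thesis using assms degree_eq_card[OF root_in] by (simp add: branching_function_def)
qed

lemma degree_branching:
  assumes "branching_function V \<omega> x0 b" "x \<in> V"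
  shows "degree V \<omega> x = real (b (dist_root x)) + (if x = x0 then 0 else 1)"
proof (cases "x = x0")
  case False
  hence "1 \<le> dist_root x" using dist_root_eq_0_iff[OF assms(2)] by simp
  thus ?thesis using assms False by (auto simp: branching_function_def graph_sphere_def)
qed (use assms in \<open>simp add: branching_function_def\<close>)

text \<open>Away from the root, one of the \<open>b r + 1\<close> neighbours is the parent.\<close>

lemma card_children_le:
  assumes b: "branching_function V \<omega> x0 b" and x: "x \<in> V"
  shows "card {y \<in> nbrs x. dist_root y = Suc (dist_root x)} \<le> b (dist_root x)"
    (is "card ?C \<le> _")
proof (cases "x = x0")
  case True
  have "card ?C \<le> card (nbrs x)" by (rule card_mono) (use finite_nbrs[OF x] in auto)
  thus ?thesis using degree_branching[OF b x] degree_eq_card[OF x] True by simp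
next
  case False
  have "card (insert (parent x) ?C) \<le> card (nbrs x)"
    by (rule card_mono) (use finite_nbrs[OF x] parent[OF x False] in auto)
  moreover have "parent x \<notin> ?C" using parent(3)[OF x False] by auto
  moreover have "finite ?C" by (rule finite_subset[OF _ finite_nbrs[OF x]]) auto
  ultimately have "Suc (card ?C) \<le> card (nbrs x)" by simp
  thus ?thesis using degree_branching[OF b x] degree_eq_card[OF x] False by simp
qed

text \<open>The sphere of radius \<open>r + 1\<close> is covered by the children of the points of radius \<open>r\<close>.\<close>

lemma sphere_card_le:
  assumes b: "branching_function V \<omega> x0 b"
  shows "finite (graph_sphere V \<omega> x0 r) \<and> card (graph_sphere V \<omega> x0 r) \<le> (\<Prod>k<r. b k)"
proof (induction r)
  case 0
  have "graph_sphere V \<omega> x0 0 = {x0}"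
    using dist_root_eq_0_iff root_in by (auto simp: graph_sphere_def)
  thus ?case by simp
next
  case (Suc r)
  let ?S = "graph_sphere V \<omega> x0"
  let ?C = "\<lambda>x. {y \<in> nbrs x. dist_root y = Suc (dist_root x)}"
  have cover: "?S (Suc r) \<subseteq> (\<Union>x\<in>?S r. ?C x)"
  proof
    fix y assume "y \<in> ?S (Suc r)"
    hence y: "y \<in> V" "dist_root y = Suc r" by (auto simp: graph_sphere_def)
    hence "y \<noteq> x0" by auto
    note p = parent[OF y(1) this]
    have "parent y \<in> ?S r" "y \<in> ?C (parent y)"
      using p y adjacent_sym[of y "parent y"] by (auto simp: graph_sphere_def)
    thus "y \<in> (\<Union>x\<in>?S r. ?C x)" by blast
  qed
  have fin: "finite (\<Union>x\<in>?S r. ?C x)"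
  proof (rule finite_UN_I)
    fix x assume "x \<in> ?S r"
    hence "x \<in> V" by (simp add: graph_sphere_def)
    from finite_nbrs[OF this] show "finite (?C x)" by (rule rev_finite_subset) auto
  qed (use Suc.IH in simp)
  have "card (?S (Suc r)) \<le> card (\<Union>x\<in>?S r. ?C x)" using fin cover by (rule card_mono)
  also have "\<dots> \<le> (\<Sum>x\<in>?S r. card (?C x))" using Suc.IH by (intro card_UN_le) simp
  also have "\<dots> \<le> (\<Sum>x\<in>?S r. b r)"
    using card_children_le[OF b] by (intro sum_mono) (auto simp: graph_sphere_def)
  also have "\<dots> \<le> (\<Prod>k<Suc r. b k)" using Suc.IH by simp
  finally show ?case using finite_subset[OF cover fin] by simp
qed

lemma root_ball_eq_UN: "root_ball n = (\<Union>r\<le>n. graph_sphere V \<omega> x0 r)"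
  by (auto simp: graph_sphere_def)

lemma finite_root_ball: "branching_function V \<omega> x0 b \<Longrightarrow> finite (root_ball n)"
  unfolding root_ball_eq_UN using sphere_card_le by blast

lemma sum_radial_root_ball_le:
  assumes b: "branching_function V \<omega> x0 b" and w: "\<And>r. 0 \<le> (w r :: real)"
  shows "(\<Sum>x\<in>root_ball n. w (dist_root x)) \<le> (\<Sum>r\<le>n. real (\<Prod>k<r. b k) * w r)"
proof -
  have "(\<Sum>x\<in>root_ball n. w (dist_root x)) =
      (\<Sum>r\<le>n. \<Sum>x\<in>graph_sphere V \<omega> x0 r. w (dist_root x))"
    unfolding root_ball_eq_UN using sphere_card_le[OF b]
    by (intro sum.UNION_disjoint) (auto simp: graph_sphere_def)
  also have "\<dots> = (\<Sum>r\<le>n. real (card (graph_sphere V \<omega> x0 r)) * w r)"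
    by (intro sum.cong) (auto simp: graph_sphere_def)
  also have "\<dots> \<le> (\<Sum>r\<le>n. real (\<Prod>k<r. b k) * w r)"
    using sphere_card_le[OF b] w by (intro sum_mono mult_right_mono of_nat_mono) auto
  finally show ?thesis .
qed

section \<open>Exponential weights as test functions\<close>

text \<open>
  This is \<open>\<Delta>w \<ge> - B w\<close> for the truncated exponential weight, already paired with \<open>v\<close>. Writing it with the
  Laplacian on \<open>v\<close> replaces Green's formula by a rearrangement of finitely many terms: in the sum of
  \<open>w x * v y\<close> over edges, keep only those from a parent \<open>x\<close> to its child \<open>y\<close> in the ball. The weight of the
  parent is at least that of the child, so these edges contribute at least \<open>w y * v y\<close> for every \<open>y\<close> other
  than the root. This compensates the summand \<open>1\<close> in the degree \<open>b r + 1\<close>.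
\<close>

lemma root_ball_laplacian_test:
  assumes b: "branching_function V \<omega> x0 b" and B: "\<And>r. real (b r) \<le> B" and "0 \<le> a"
    and v: "\<And>x. x \<in> V \<Longrightarrow> 0 \<le> v x"
  shows "- B * (\<Sum>x\<in>root_ball n. exp (- a * real (dist_root x)) * v x)
    \<le> (\<Sum>x\<in>root_ball n. exp (- a * real (dist_root x)) * laplacian V \<omega> \<mu> v x)"
proof -
  define w where "w = (\<lambda>x. exp (- a * real (dist_root x)))"
  let ?b = "root_ball n"
  have fin: "finite ?b" using b by (rule finite_root_ball)
  have w_pos: "0 \<le> w x" for x by (simp add: w_def)
  have w_parent: "w y \<le> w (parent y)" if "y \<in> V" "y \<noteq> x0" for y
    using parent(3)[OF that] \<open>0 \<le> a\<close> by (auto simp: w_def intro!: mult_left_mono)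
  \<comment> \<open>The edges that lead from a parent to its child, indexed by the child.\<close>
  let ?E = "(\<lambda>y. (parent y, y)) ` (?b - {x0})"
  have "(\<Sum>x\<in>?b. if x = x0 then 0 else w x * v x) = (\<Sum>y\<in>?b - {x0}. w y * v y)"
    using fin by (intro sum.mono_neutral_cong_right) auto
  also have "\<dots> \<le> (\<Sum>y\<in>?b - {x0}. w (parent y) * v y)"
    using v w_parent by (intro sum_mono mult_right_mono) auto
  also have "\<dots> = (\<Sum>(x, y)\<in>?E. w x * v y)"
    by (subst sum.reindex) (auto simp: inj_on_def)
  also have "\<dots> \<le> (\<Sum>(x, y)\<in>Sigma ?b nbrs. w x * v y)"
  proof (rule sum_mono2)
    show "finite (Sigma ?b nbrs)" using fin finite_nbrs by (intro finite_SigmaI) auto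
    show "?E \<subseteq> Sigma ?b nbrs"
    proof (rule image_subsetI)
      fix y assume y: "y \<in> ?b - {x0}"
      hence "y \<in> V" "y \<noteq> x0" by auto
      note p = parent[OF this]
      have "adjacent \<omega> (parent y) y" using p \<open>y \<in> V\<close> adjacent_sym by blast
      thus "(parent y, y) \<in> Sigma ?b nbrs" using p y by auto
    qed
  qed (use v w_pos in auto)
  also have "\<dots> = (\<Sum>x\<in>?b. w x * (\<Sum>y\<in>nbrs x. v y))"
    unfolding sum_distrib_left by (rule sum.Sigma[symmetric]) (use fin finite_nbrs in auto)
  finally have gain: "(\<Sum>x\<in>?b. if x = x0 then 0 else w x * v x)
      \<le> (\<Sum>x\<in>?b. w x * (\<Sum>y\<in>nbrs x. v y))" .
  have "- B * (\<Sum>x\<in>?b. w x * v x) = (\<Sum>x\<in>?b. - (B * (w x * v x)))"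
    by (simp add: sum_distrib_left sum_negf)
  also have "\<dots> \<le> (\<Sum>x\<in>?b. (if x = x0 then 0 else w x * v x) - w x * (degree V \<omega> x * v x))"
  proof (rule sum_mono)
    fix x assume x: "x \<in> ?b"
    have "real (b (dist_root x)) * (w x * v x) \<le> B * (w x * v x)"
      using B w_pos v x by (intro mult_right_mono) auto
    thus "- (B * (w x * v x))
        \<le> (if x = x0 then 0 else w x * v x) - w x * (degree V \<omega> x * v x)"
      using x degree_branching[OF b, of x] by (auto simp: algebra_simps)
  qed
  also have "\<dots> \<le> (\<Sum>x\<in>?b. w x * (\<Sum>y\<in>nbrs x. v y)) - (\<Sum>x\<in>?b. w x * (degree V \<omega> x * v x))"
    using gain by (simp add: sum_subtractf)
  also have "\<dots> = (\<Sum>x\<in>?b. w x * laplacian V \<omega> \<mu> v x)"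
    unfolding sum_subtractf[symmetric]
    by (intro sum.cong) (auto simp: laplacian_eq_sum_nbrs right_diff_distrib)
  finally show ?thesis by (simp add: w_def)
qed

text \<open>
  The condition on \<open>a\<close> says \<open>B e\<^sup>-\<^sup>a < 1\<close>, so a geometric series dominates the sum over spheres.
  Summability is what bounds the partial sums by \<open>infsum\<close>, whose value is \<open>0\<close> for a divergent sum.
\<close>

lemma root_ball_mass_le:
  assumes b: "branching_function V \<omega> x0 b" and B: "\<And>r. real (b r) \<le> B" and a: "a > ln B"
  defines "c \<equiv> (\<lambda>r. (\<Prod>k\<in>{0..<r}. real (b k)) * exp (- a * real r))"
  shows "(\<Sum>x\<in>root_ball n. exp (- a * real (dist_root x))) \<le> 1 + (\<Sum>\<^sub>\<infinity>r\<in>{1..}. c r)"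
proof -
  have "1 \<le> B" using branching_root_pos[OF b] B[of 0] by simp
  have c_nonneg: "0 \<le> c r" for r by (simp add: c_def prod_nonneg)
  have "exp (- a) < exp (- ln B)" using a by simp
  hence ratio: "B * exp (- a) < 1" using \<open>1 \<le> B\<close> by (simp add: exp_minus field_simps)
  have c_le: "c r \<le> (B * exp (- a)) ^ r" for r
  proof -
    have "(\<Prod>k\<in>{0..<r}. real (b k)) \<le> (\<Prod>k\<in>{0..<r}. B)"
      using B by (intro prod_mono) auto
    thus ?thesis by (simp add: c_def power_mult_distrib exp_of_nat_mult[symmetric] mult.commute)
  qed
  have "summable (\<lambda>r. norm (c r))"
    by (rule summable_comparison_test'[where N = 0, OF summable_geometric[of "B * exp (- a)"]])
      (use ratio \<open>1 \<le> B\<close> c_le c_nonneg in auto)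
  hence c_summable: "c summable_on {1..}"
    by (rule summable_on_subset_banach[OF norm_summable_imp_summable_on]) auto
  have "(\<Sum>x\<in>root_ball n. exp (- a * real (dist_root x)))
      \<le> (\<Sum>r\<le>n. real (\<Prod>k<r. b k) * exp (- a * real r))"
    using sum_radial_root_ball_le[OF b, of "\<lambda>r. exp (- a * real r)"] by simp
  also have "\<dots> = (\<Sum>r\<in>insert 0 {1..n}. c r)"
    by (intro sum.cong) (auto simp: c_def lessThan_atLeast0)
  also have "\<dots> = 1 + (\<Sum>r\<in>{1..n}. c r)" by (subst sum.insert) (auto simp: c_def)
  also have "(\<Sum>r\<in>{1..n}. c r) \<le> (\<Sum>\<^sub>\<infinity>r\<in>{1..}. c r)"
    using c_nonneg by (intro finite_sum_le_infsum[OF c_summable]) auto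
  finally show ?thesis by simp
qed

end

section \<open>Blow-up\<close>

text \<open>
  The average \<open>g\<close> of \<open>u\<close> over a finite ball satisfies \<open>g' \<ge> f(g) - B g\<close>: the Laplacian contributes at
  least \<open>- B g\<close> by the choice of the weight, and the reaction term at least \<open>f(g)\<close> by Jensen's
  inequality.
\<close>

lemma (in model_tree) no_global_solution:
  fixes f :: "real \<Rightarrow> real"
  assumes f_convex: "convex_on {0..} f" and f_zero: "f 0 = 0"
    and f_pos: "\<And>v. v > 0 \<Longrightarrow> f v > 0"
    and f_integral: "set_integrable lborel {1..} (\<lambda>v. 1 / f v)"
    and b: "branching_function V \<omega> x0 b" and B: "\<And>r. real (b r) \<le> B" and a: "a > ln B"
    and solution: "is_solution V \<omega> \<mu> f u0 \<infinity> u"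
    and u0_nonneg: "\<And>x. x \<in> V \<Longrightarrow> 0 \<le> u0 x"
    and C: "0 \<le> C" "\<And>n. C * (\<Sum>x\<in>root_ball n. exp (- a * real (dist_root x))) \<le> 1"
    and "B \<le> l" and c: "0 < c" "f c / c > l"
    and large: "c < (\<Sum>x\<in>root_ball n. u0 x * (C * exp (- a * real (dist_root x))))"
  shows False
proof -
  define \<phi> where "\<phi> = (\<lambda>x. C * exp (- a * real (dist_root x)))"
  define g where "g = (\<lambda>t. \<Sum>x\<in>root_ball n. \<phi> x * u x t)"
  define g' where "g' = (\<lambda>t. \<Sum>x\<in>root_ball n. \<phi> x * deriv (u x) t)"
  have fin: "finite (root_ball n)" using b by (rule finite_root_ball)
  have "1 \<le> B" using branching_root_pos[OF b] B[of 0] by simp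
  hence "0 \<le> a" using a ln_ge_zero[of B] by linarith
  have \<phi>_nonneg: "0 \<le> \<phi> x" for x using C by (simp add: \<phi>_def)
  have half_line: "{t. 0 < t \<and> ereal t < \<infinity>} = {0<..}" "{t. 0 \<le> t \<and> ereal t < \<infinity>} = {0..}"
    by auto
  have u_C1: "u x C1_differentiable_on {0<..}" and u_cont: "continuous_on {0..} (u x)"
    and u_initial: "u x 0 = u0 x" if "x \<in> V" for x
    using solution that unfolding is_solution_def half_line by blast+
  have u_nonneg': "0 \<le> u x t"
    and u_eq: "deriv (u x) t - laplacian V \<omega> \<mu> (\<lambda>y. u y t) x = f (u x t)"
    if "x \<in> V" "0 < t" for x t
  proof -
    have "ereal t < \<infinity>" by simp
    thus "0 \<le> u x t" "deriv (u x) t - laplacian V \<omega> \<mu> (\<lambda>y. u y t) x = f (u x t)"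
      using solution that unfolding is_solution_def by blast+
  qed
  have u_nonneg: "0 \<le> u x t" if "x \<in> V" "0 \<le> t" for x t
    using that u_nonneg'[of x t] u_initial[of x] u0_nonneg[of x] by (cases "t = 0") auto
  have u_deriv: "(u x has_real_derivative deriv (u x) t) (at t)" if "x \<in> V" "0 < t" for x t
  proof -
    have "u x differentiable at t"
      using u_C1[OF that(1)] that(2) by (auto simp: C1_differentiable_on_eq)
    thus ?thesis by (simp add: DERIV_deriv_iff_real_differentiable)
  qed
  show False
  proof (rule superlinear_differential_inequality_not_global[OF f_convex f_zero f_pos f_integral])
    show "0 \<le> l" using \<open>1 \<le> B\<close> \<open>B \<le> l\<close> by simp
    show "0 < c" "f c / c > l" by fact+
    have "g 0 = (\<Sum>x\<in>root_ball n. u0 x * (C * exp (- a * real (dist_root x))))"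
      unfolding g_def \<phi>_def by (intro sum.cong) (auto simp: u_initial)
    thus "c < g 0" using large by simp
    show "continuous_on {0..} g"
      unfolding g_def using u_cont by (intro continuous_intros) auto
  next
    fix t :: real assume t: "t > 0"
    show "(g has_real_derivative g' t) (at t)"
      unfolding g_def g'_def using u_deriv t by (intro DERIV_sum DERIV_cmult) auto
    have "g' t = (\<Sum>x\<in>root_ball n. \<phi> x * (laplacian V \<omega> \<mu> (\<lambda>y. u y t) x + f (u x t)))"
      unfolding g'_def using u_eq[OF _ t, symmetric] by (intro sum.cong) auto
    also have "\<dots> = C * (\<Sum>x\<in>root_ball n. exp (- a * real (dist_root x))
          * laplacian V \<omega> \<mu> (\<lambda>y. u y t) x) + (\<Sum>x\<in>root_ball n. \<phi> x * f (u x t))"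
      by (simp add: \<phi>_def distrib_left sum.distrib sum_distrib_left mult.assoc)
    finally have g'_eq: "g' t = \<dots>" .
    have "C * (- B * (\<Sum>x\<in>root_ball n. exp (- a * real (dist_root x)) * u x t))
        \<le> C * (\<Sum>x\<in>root_ball n. exp (- a * real (dist_root x))
          * laplacian V \<omega> \<mu> (\<lambda>y. u y t) x)"
      using C(1) root_ball_laplacian_test[OF b B \<open>0 \<le> a\<close>, of "\<lambda>y. u y t"] u_nonneg t
      by (intro mult_left_mono) auto
    also have "C * (- B * (\<Sum>x\<in>root_ball n. exp (- a * real (dist_root x)) * u x t)) = - B * g t"
      by (simp add: g_def \<phi>_def sum_distrib_left mult_ac)
    finally have transport: "- B * g t \<le> C * (\<Sum>x\<in>root_ball n.
        exp (- a * real (dist_root x)) * laplacian V \<omega> \<mu> (\<lambda>y. u y t) x)" .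
    have "f (g t) \<le> (\<Sum>x\<in>root_ball n. \<phi> x * f (u x t))"
      unfolding g_def
    proof (rule convex_on_sum_sub_probability[OF f_convex f_zero fin])
      show "(\<Sum>x\<in>root_ball n. \<phi> x) \<le> 1"
        using C(2)[of n] by (simp add: \<phi>_def sum_distrib_left)
    qed (use \<phi>_nonneg u_nonneg t in auto)
    with transport have "f (g t) - B * g t \<le> g' t" unfolding g'_eq by linarith
    moreover have "B * g t \<le> l * g t"
      using \<open>B \<le> l\<close> \<phi>_nonneg u_nonneg t
      by (intro mult_right_mono) (auto simp: g_def intro!: sum_nonneg)
    ultimately show "f (g t) - l * g t \<le> g' t" by simp
  qed
qed

theorem theorem4p5:
  fixes f :: "real \<Rightarrow> real"
    and V :: "'a set" and \<omega>0 :: "'a \<Rightarrow> 'a \<Rightarrow> real" and \<mu>1 :: "'a \<Rightarrow> real" and x0 :: 'a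
    and b :: "nat \<Rightarrow> nat" and B a C l :: real
    and u0 \<phi> :: "'a \<Rightarrow> real" and u :: "'a \<Rightarrow> real \<Rightarrow> real" and T :: ereal
  assumes f_nonneg: "\<And>v. v \<ge> 0 \<Longrightarrow> f v \<ge> 0"
    and f_lipschitz: "locally_lipschitz_on {0..} f"
    and f_convex: "convex_on {0..} f"
    and f_zero: "f 0 = 0"
    and f_pos: "\<And>v. v > 0 \<Longrightarrow> f v > 0"
    and f_integral: "set_integrable lborel {1..} (\<lambda>v. 1 / f v)"
    and f_superlinear: "filterlim (\<lambda>v. f v / v) at_top at_top"
    and tree: "model_tree V \<omega>0 \<mu>1 x0"
    and branching: "branching_function V \<omega>0 x0 b"
    and b_bounded: "bdd_above (range (\<lambda>r. real (b r)))"
    and B_eq: "B = (SUP r. real (b r))"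
    and a_gt: "a > ln B"
    and u0_nonneg: "\<And>x. x \<in> V \<Longrightarrow> u0 x \<ge> 0"
    and u0_bounded: "in_linfty V u0"
    and u0_nonzero: "\<exists>x\<in>V. u0 x \<noteq> 0"
    and solution: "is_maximal_solution V \<omega>0 \<mu>1 f u0 T u"
    and C_eq: "C = inverse (1 + (\<Sum>\<^sub>\<infinity>r\<in>{1..}. (\<Prod>k\<in>{0..<r}. real (b k)) * exp (- a * real r)))"
    and \<phi>_eq: "\<And>x. x \<in> V \<Longrightarrow> \<phi> x = C * exp (- a * real (graph_dist V \<omega>0 x x0))"
    and l_ge: "l \<ge> B"
    and initial_large: "(\<Sum>\<^sub>\<infinity>x\<in>V. u0 x * \<phi> x) > s0 f l"
  shows "blows_up_in_finite_time V T u"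
proof (cases "T = \<infinity>")
  case False
  hence "norm_explodes V T u"
    using solution by (simp add: is_maximal_solution_def is_global_def)
  moreover have "in_linfty V (\<lambda>x. u x t)" if t: "0 < t" "ereal t < T" for t
  proof -
    have "bounded {u x s | x s. x \<in> V \<and> 0 \<le> s \<and> s \<le> t}"
      using solution t by (auto simp: is_maximal_solution_def is_solution_def)
    thus ?thesis unfolding in_linfty_def by (rule bounded_subset) (use t less_imp_le in blast)
  qed
  ultimately show ?thesis
    using solution
    by (auto simp: blows_up_in_finite_time_def norm_explodes_def is_maximal_solution_def
        is_solution_def)
next
  case True
  interpret model_tree V \<omega>0 \<mu>1 x0 by (rule tree)
  have B: "real (b r) \<le> B" for r unfolding B_eq using b_bounded by (intro cSUP_upper) auto
  let ?D = "\<Sum>\<^sub>\<infinity>r\<in>{1..}. (\<Prod>k\<in>{0..<r}. real (b k)) * exp (- a * real r)"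
  have "0 \<le> ?D" by (intro infsum_nonneg mult_nonneg_nonneg prod_nonneg) auto
  hence C: "0 < C" "C * (1 + ?D) = 1" by (auto simp: C_eq)
  have C_mass: "C * (\<Sum>x\<in>root_ball n. exp (- a * real (dist_root x))) \<le> 1" for n
  proof -
    have "C * (\<Sum>x\<in>root_ball n. exp (- a * real (dist_root x))) \<le> C * (1 + ?D)"
      using root_ball_mass_le[OF branching B a_gt] C(1) by (intro mult_left_mono) auto
    thus ?thesis unfolding C(2) .
  qed
  have \<phi>_nonneg: "0 \<le> \<phi> x" if "x \<in> V" for x using C that by (simp add: \<phi>_eq)
  let ?S = "{v. v > 0 \<and> f v / v > l}"
  have "eventually (\<lambda>v. f v / v > l \<and> v > 0) at_top"
    using f_superlinear eventually_gt_at_top[of 0]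
    by (auto simp: filterlim_at_top_dense intro: eventually_conj)
  then obtain v where "f v / v > l \<and> v > 0"
    using eventually_happens'[OF trivial_limit_at_top_linorder] by blast
  hence S: "?S \<noteq> {}" by blast
  \<comment> \<open>A divergent \<open>infsum\<close> is \<open>0\<close>, so the largeness of the initial datum contains its summability.\<close>
  have "0 \<le> s0 f l" unfolding s0_def using S by (intro cInf_greatest) auto
  have summable: "(\<lambda>x. u0 x * \<phi> x) summable_on V"
  proof (rule ccontr)
    assume "\<not> ?thesis"
    hence "(\<Sum>\<^sub>\<infinity>x\<in>V. u0 x * \<phi> x) = 0" by (rule infsum_not_exists)
    thus False using initial_large \<open>0 \<le> s0 f l\<close> by simp
  qed
  \<comment> \<open>Already a finite part of the initial sum exceeds \<open>s0 f l\<close>, and nonnegativity extends it to a ball.\<close>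
  have "\<exists>F. finite F \<and> F \<subseteq> V \<and> s0 f l < (\<Sum>x\<in>F. u0 x * \<phi> x)"
  proof (rule ccontr)
    assume "\<not> ?thesis"
    hence "(\<Sum>\<^sub>\<infinity>x\<in>V. u0 x * \<phi> x) \<le> s0 f l"
      by (intro infsum_le_finite_sums[OF summable]) (meson not_less)
    thus False using initial_large by simp
  qed
  then obtain F where F: "finite F" "F \<subseteq> V" "s0 f l < (\<Sum>x\<in>F. u0 x * \<phi> x)" by blast
  obtain n where n: "\<And>x. x \<in> F \<Longrightarrow> dist_root x \<le> n"
    using finite_nat_set_iff_bounded_le[of "dist_root ` F"] F by auto
  have "(\<Sum>x\<in>F. u0 x * \<phi> x) \<le> (\<Sum>x\<in>root_ball n. u0 x * \<phi> x)"
    using finite_root_ball[OF branching] F n u0_nonneg \<phi>_nonneg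
    by (intro sum_mono2) auto
  hence "Inf ?S < (\<Sum>x\<in>root_ball n. u0 x * \<phi> x)" using F by (simp add: s0_def)
  then obtain c where c: "c \<in> ?S" "c < (\<Sum>x\<in>root_ball n. u0 x * \<phi> x)"
    using cInf_lessD[OF S] by blast
  have False
  proof (rule no_global_solution)
    show "is_solution V \<omega>0 \<mu>1 f u0 \<infinity> u"
      using solution True by (simp add: is_maximal_solution_def)
    show "0 < c" "f c / c > l" using c by auto
    have "(\<Sum>x\<in>root_ball n. u0 x * \<phi> x)
        = (\<Sum>x\<in>root_ball n. u0 x * (C * exp (- a * real (dist_root x))))"
      by (intro sum.cong) (auto simp: \<phi>_eq)
    thus "c < \<dots>" using c by simp
  qed (use f_convex f_zero f_pos f_integral branching B a_gt u0_nonneg C C_mass l_ge in auto)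
  thus ?thesis ..
qed

end
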